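(* Let $n<p$, let $\mathbf X\in\mathbb R^{p\times n}$ be a fixed (non-random) matrix of full column rank $n$, and let $\mathbf A\in\mathbb R^{n\times K}$ be a fixed matrix of full column rank $K$. Put $\mathbf P_{\mathbf A}=\mathbf A(\mathbf A^\top\mathbf A)^{-1}\mathbf A^\top$, $\hat{\mathbf M}=\mathbf X\mathbf A(\mathbf A^\top\mathbf A)^{-1}$ and $\mathbf S=\mathbf X(\mathbf I_n-\mathbf P_{\mathbf A})\mathbf X^\top$. Let $\gamma>0$, let $\hat\Sigma_\gamma=c(\mathbf S+\gamma\mathbf I_p)$ for some constant $c>0$, let $\boldsymbol\theta\in\mathbb R^K$ be nonzero, and let $\mathbf y$ be a random vector in $\mathbb R^p$ with $$\mathrm E[\mathbf y]=\hat{\mathbf M}\boldsymbol\theta,\qquad \mathrm{Var}[\mathbf y]=\|\boldsymbol\theta\|_2^2\,\hat\Sigma_\gamma .$$ Let $$\hat{\boldsymbol\theta}_{\mathrm{ATR}}=(\hat{\mathbf M}^\top\hat{\mathbf M})^{-1}\hat{\mathbf M}^\top\mathbf y,\qquad \hat{\boldsymbol\theta}_{\mathrm{RTS}}=\mathbf A^\top(\mathbf X^\top\mathbf X)^{-1}\mathbf X^\top\mathbf y,$$ $$\mathbf V_1=\mathbf A^\top(\mathbf X^\top\mathbf X)^{-1}\mathbf A-(\hat{\mathbf M}^\top\hat{\mathbf M})^{-1},\qquad \mathbf V_2=(\hat{\mathbf M}^\top\hat{\mathbf M})^{-1}\hat{\mathbf M}^\top\mathbf S\hat{\mathbf M}(\hat{\mathbf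 M}^\top\hat{\mathbf M})^{-1},$$ and assume $\mathbf V_1$ is invertible. Then $$\mathrm{Var}[\hat{\boldsymbol\theta}_{\mathrm{RTS}}]\preceq\mathrm{Var}[\hat{\boldsymbol\theta}_{\mathrm{ATR}}]\quad\text{if and only if}\quad \gamma\le\lambda_{\min}(\mathbf V_1^{-1}\mathbf V_2),$$ where $\lambda_{\min}$ denotes the minimum eigenvalue.
   Context: For a random vector, $\mathrm{Var}$ denotes its covariance matrix. $\preceq$ is the Loewner order on symmetric matrices: $\mathbf B\preceq\mathbf C$ means $\mathbf C-\mathbf B$ is positive semidefinite. *)

theory Defs
  imports "HOL-Probability.Probability"
begin

definition covariance_matrix :: "'w measure \<Rightarrow> ('w \<Rightarrow> real ^ 'd) \<Rightarrow> real ^ 'd ^ 'd" where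
  "covariance_matrix M Z = (\<chi> i j.
     integral\<^sup>L M (\<lambda>\<omega>. (Z \<omega> $ i - integral\<^sup>L M Z $ i) * (Z \<omega> $ j - integral\<^sup>L M Z $ j)))"

definition pos_semidef :: "real ^ 'd ^ 'd \<Rightarrow> bool" where
  "pos_semidef B \<longleftrightarrow> transpose B = B \<and> (\<forall>v. 0 \<le> v \<bullet> (B *v v))"

definition loewner_le :: "real ^ 'd ^ 'd \<Rightarrow> real ^ 'd ^ 'd \<Rightarrow> bool" (infix "\<preceq>\<^sub>L" 50) where
  "B \<preceq>\<^sub>L C \<longleftrightarrow> pos_semidef (C - B)"

definition eigenvalues :: "real ^ 'd ^ 'd \<Rightarrow> real set" where
  "eigenvalues B = {\<mu>. \<exists>v. v \<noteq> 0 \<and> B *v v = \<mu> *\<^sub>R v}"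

(* Only real eigenvalues are considered: "minimum" is meaningful only for a matrix whose spectrum
   is real, e.g. a product of a positive definite and a positive semidefinite matrix. Min is
   unspecified if there is no real eigenvalue. *)
definition lambda_min :: "real ^ 'd ^ 'd \<Rightarrow> real" where
  "lambda_min B = Min (eigenvalues B)"

end

theory Submission
  imports Defs
begin

text \<open>
  Both estimators are linear in \<open>y\<close> and satisfy \<open>L ** M_hat = mat 1\<close>; for the RTS matrix \<open>L\<close> one has
  in addition \<open>L ** S ** transpose L = 0\<close>. Hence, up to the positive factor \<open>(norm \<theta>)\<^sup>2 * c\<close>, the
  difference of the two covariance matrices is \<open>V2 - \<gamma> *\<^sub>R V1\<close>. With \<open>H\<close> the ATR matrix,
  \<open>V1 = (L - H) ** transpose (L - H)\<close>, so an invertible \<open>V1\<close> is positive definite, and the least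
  eigenvalue of \<open>matrix_inv V1 ** V2\<close> is the minimum of the generalised Rayleigh quotient
  of \<open>V2\<close> relative to \<open>V1\<close>.
\<close>

section \<open>Real matrices\<close>

lemma matrix_diff_ldistrib: "A ** (B - C) = A ** B - A ** (C :: real ^ 'n ^ 'm)"
  by (simp add: matrix_eq algebra_simps flip: matrix_vector_mul_assoc)

lemma matrix_diff_rdistrib: "(A - B) ** C = A ** C - (B :: real ^ 'n ^ 'm) ** C"
  by (simp add: matrix_eq algebra_simps flip: matrix_vector_mul_assoc)

lemma matrix_add_rdistrib_real: "(A + B) ** C = A ** C + (B :: real ^ 'n ^ 'm) ** C"
  by (simp add: matrix_eq algebra_simps flip: matrix_vector_mul_assoc)

lemma matrix_mult_scaleR_left: "(r *\<^sub>R A) ** B = r *\<^sub>R (A ** (B :: real ^ 'n ^ 'm))"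
  by (simp add: matrix_eq flip: matrix_vector_mul_assoc scaleR_matrix_vector_assoc)

lemma matrix_mult_scaleR_right: "A ** (r *\<^sub>R B) = r *\<^sub>R (A ** (B :: real ^ 'n ^ 'm))"
  by (simp add: matrix_eq matrix_scaleR_vector_ac
      flip: matrix_vector_mul_assoc scaleR_matrix_vector_assoc)

lemma transpose_diff: "transpose (A - B) = transpose A - transpose (B :: real ^ 'n ^ 'm)"
  by (simp add: transpose_def vec_eq_iff)

lemma matrix_inv_inverse:
  assumes "invertible A"
  shows "A ** matrix_inv A = mat 1" "matrix_inv A ** A = mat 1"
  using someI_ex[OF assms[unfolded invertible_def]] by (simp_all add: matrix_inv_def)

lemma symmetric_matrix_inv:
  fixes A :: "real ^ 'n ^ 'n"
  assumes "invertible A" "transpose A = A"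
  shows "transpose (matrix_inv A) = matrix_inv A"
proof -
  have "transpose (matrix_inv A) ** A = mat 1"
    using arg_cong[OF matrix_inv_inverse(1)[OF assms(1)], of transpose] assms(2)
    by (simp add: matrix_transpose_mul)
  then show ?thesis
    by (metis assms(1) matrix_inv_inverse(1) matrix_mul_assoc matrix_mul_lid matrix_mul_rid)
qed

lemma symmetric_gram: "transpose (transpose A ** A) = transpose A ** (A :: real ^ 'n ^ 'm)"
  by (simp add: matrix_transpose_mul)

lemma inner_symmetric_matrix:
  fixes B :: "real ^ 'n ^ 'n"
  assumes "transpose B = B"
  shows "v \<bullet> (B *v w) = w \<bullet> (B *v v)"
  by (metis assms dot_lmul_matrix inner_commute transpose_matrix_vector)

text \<open>A vector \<open>v\<close> in the kernel of the Gram matrix has \<open>A *v v\<close> of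
  squared length 0. This supplies the inverses for \<open>X\<close>, \<open>A\<close> and later
  \<open>M_hat\<close>.\<close>

lemma invertible_gram:
  fixes A :: "real ^ 'n ^ 'm"
  assumes "inj ((*v) A)"
  shows "invertible (transpose A ** A)"
proof -
  have "v = 0" if "(transpose A ** A) *v v = 0" for v
  proof -
    have "(A *v v) \<bullet> (A *v v) = 0"
      using that by (metis dot_lmul_matrix inner_zero_left matrix_vector_mul_assoc transpose_matrix_vector)
    then show ?thesis
      using assms by (metis inner_eq_zero_iff injD matrix_vector_mult_0_right)
  qed
  then show ?thesis
    by (simp add: invertible_left_inverse matrix_left_invertible_ker)
qed

lemma inner_mult_transpose:
  fixes D :: "real ^ 'm ^ 'n"
  shows "v \<bullet> ((D ** transpose D) *v v) = (norm (transpose D *v v))\<^sup>2"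
  by (metis dot_lmul_matrix matrix_vector_mul_assoc power2_norm_eq_inner transpose_matrix_vector)

section \<open>Positive semidefinite matrices\<close>

lemma pos_semidef_scaleR_iff:
  assumes "r > 0"
  shows "pos_semidef (r *\<^sub>R B) \<longleftrightarrow> pos_semidef B"
  using assms
  by (auto simp: pos_semidef_def transpose_scalar zero_le_mult_iff simp flip: scaleR_matrix_vector_assoc)

text \<open>At \<open>v\<close> the form attains its minimum 0. If \<open>w = B *v v\<close> were
  nonzero, a suitable step from \<open>v\<close> along \<open>- w\<close> would make the form
  negative. This later turns a minimiser of a Rayleigh quotient into an eigenvector.\<close>

lemma pos_semidef_kernel:
  fixes B :: "real ^ 'n ^ 'n"
  assumes "pos_semidef B" and "v \<bullet> (B *v v) = 0"
  shows "B *v v = 0"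
proof -
  define w where "w = B *v v"
  define q where "q = w \<bullet> (B *v w)"
  define n where "n = w \<bullet> w"
  \<comment> \<open>For \<open>q > 0\<close> the quadratic \<open>2 * t * n + t\<^sup>2 * q\<close>
    is least at \<open>- n / q\<close>. The denominator \<open>q + 1\<close> also covers
    \<open>q = 0\<close> and still gives a negative value whenever \<open>n\<close> is
    nonzero.\<close>
  define t where "t = - n / (q + 1)"
  have sym: "transpose B = B" and psd: "0 \<le> u \<bullet> (B *v u)" for u
    using assms(1) by (auto simp: pos_semidef_def)
  have q: "q \<ge> 0"
    using psd by (simp add: q_def)
  have "v \<bullet> (B *v w) = n"
    using inner_symmetric_matrix[OF sym] by (simp add: n_def w_def)
  then have "(v + t *\<^sub>R w) \<bullet> (B *v (v + t *\<^sub>R w)) = 2 * t * n + t\<^sup>2 * q"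
    using assms(2)
    by (simp add: algebra_simps inner_add_left inner_add_right power2_eq_square q_def n_def
        flip: w_def)
  also have "\<dots> = - (n\<^sup>2 * (q + 2)) / (q + 1)\<^sup>2"
    using q by (simp add: t_def divide_simps) (simp add: algebra_simps power2_eq_square)
  finally have "n\<^sup>2 * (q + 2) / (q + 1)\<^sup>2 \<le> 0"
    using psd[of "v + t *\<^sub>R w"] by simp
  moreover have "(q + 2) / (q + 1)\<^sup>2 > 0"
    using q by simp
  ultimately have "n\<^sup>2 \<le> 0"
    by (metis times_divide_eq_right mult_le_0_iff linorder_not_less)
  then show ?thesis
    by (simp add: n_def w_def)
qed

section \<open>Eigenvalues\<close>

text \<open>Induction on the set of eigenvalues: applying \<open>B\<close> minus \<nu> times the
  identity to a vanishing combination removes the new eigenvector and multiplies every other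
  coefficient by the nonzero factor \<mu> - \<nu>.\<close>

lemma eigenvectors_independent:
  fixes B :: "real ^ 'n ^ 'n"
  assumes "finite F"
    and "\<And>\<mu>. \<mu> \<in> F \<Longrightarrow> v \<mu> \<noteq> 0 \<and> B *v v \<mu> = \<mu> *\<^sub>R v \<mu>"
    and "(\<Sum>\<mu>\<in>F. a \<mu> *\<^sub>R v \<mu>) = 0" and "\<mu> \<in> F"
  shows "a \<mu> = 0"
  using assms
proof (induction F arbitrary: a \<mu> rule: finite_induct)
  case empty
  then show ?case by simp
next
  case (insert \<nu> F)
  let ?s = "\<Sum>\<mu>\<in>F. a \<mu> *\<^sub>R v \<mu>"
  have s: "a \<nu> *\<^sub>R v \<nu> + ?s = 0"
    using insert.prems(2) insert.hyps by simp
  have "B *v ?s = (\<Sum>\<mu>\<in>F. (a \<mu> * \<mu>) *\<^sub>R v \<mu>)"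
    using insert.prems(1)
    by (simp add: linear_sum[OF matrix_vector_mul_linear] matrix_vector_mult_scaleR)
  \<comment> \<open>The relation \<open>s\<close> makes \<open>?s\<close> a multiple of the
    eigenvector for \<nu>. Comparing this value with the termwise one gives a combination over
    \<open>F\<close> alone.\<close>
  moreover have "B *v ?s = \<nu> *\<^sub>R ?s"
  proof -
    have "?s = - a \<nu> *\<^sub>R v \<nu>"
      using s by (simp add: add_eq_0_iff)
    moreover have "B *v v \<nu> = \<nu> *\<^sub>R v \<nu>"
      using insert.prems(1) by simp
    ultimately show ?thesis
      by (simp only: matrix_vector_mult_scaleR) (simp add: mult.commute)
  qed
  ultimately have "(\<Sum>\<mu>\<in>F. (a \<mu> * (\<mu> - \<nu>)) *\<^sub>R v \<mu>) = 0"
    by (simp add: algebra_simps sum_subtractf scaleR_sum_right)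
  then have "a \<mu> * (\<mu> - \<nu>) = 0" if "\<mu> \<in> F" for \<mu>
    using insert.IH[of "\<lambda>\<mu>. a \<mu> * (\<mu> - \<nu>)" \<mu>] insert.prems(1) that by simp
  then have F: "a \<mu> = 0" if "\<mu> \<in> F" for \<mu>
    using that insert.hyps by fastforce
  then have "a \<nu> *\<^sub>R v \<nu> = 0"
    using s by simp
  then have "a \<nu> = 0"
    using insert.prems(1) by simp
  then show ?case
    using F insert.prems(3) by auto
qed

text \<open>One eigenvalue more than the dimension would give too many independent vectors.
  Finiteness is what makes the \<open>Min\<close> in \<open>lambda_min\<close> a true minimum once
  an eigenvalue exists.\<close>

lemma finite_eigenvalues: "finite (eigenvalues (B :: real ^ 'n ^ 'n))"
proof (rule ccontr)
  assume "infinite (eigenvalues B)"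
  then obtain F where F: "F \<subseteq> eigenvalues B" "finite F" "card F = Suc CARD('n)"
    using infinite_arbitrarily_large by blast
  obtain v where v: "v \<mu> \<noteq> 0 \<and> B *v v \<mu> = \<mu> *\<^sub>R v \<mu>" if "\<mu> \<in> F" for \<mu>
    using F(1) unfolding eigenvalues_def subset_iff mem_Collect_eq by metis
  have inj: "inj_on v F"
    by (metis (no_types) inj_onI scaleR_right_imp_eq v)
  have "independent (v ` F)"
  proof -
    have "u x = 0" if "(\<Sum>x\<in>v ` F. u x *\<^sub>R x) = 0" "x \<in> v ` F" for u x
      using that eigenvectors_independent[OF F(2) v, where a = "\<lambda>\<mu>. u (v \<mu>)"]
      by (auto simp: sum.reindex[OF inj])
    then show ?thesis
      using F(2) by (auto simp: dependent_finite)
  qed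
  then have "card (v ` F) \<le> CARD('n)"
    using independent_bound by fastforce
  then show False
    using F(3) card_image[OF inj] by simp
qed

section \<open>Generalised eigenvalues and the Rayleigh quotient\<close>

lemma eigenvalues_matrix_inv_mult:
  fixes P Q :: "real ^ 'n ^ 'n"
  assumes "invertible P"
  shows "\<mu> \<in> eigenvalues (matrix_inv P ** Q) \<longleftrightarrow> (\<exists>v. v \<noteq> 0 \<and> Q *v v = \<mu> *\<^sub>R (P *v v))"
proof -
  have "(matrix_inv P ** Q) *v v = \<mu> *\<^sub>R v \<longleftrightarrow> Q *v v = \<mu> *\<^sub>R (P *v v)" for v
  proof
    assume "(matrix_inv P ** Q) *v v = \<mu> *\<^sub>R v"
    then have "P *v ((matrix_inv P ** Q) *v v) = P *v (\<mu> *\<^sub>R v)"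
      by simp
    then show "Q *v v = \<mu> *\<^sub>R (P *v v)"
      by (simp add: matrix_vector_mul_assoc matrix_mul_assoc matrix_vector_mult_scaleR
          matrix_inv_inverse[OF assms])
  next
    assume "Q *v v = \<mu> *\<^sub>R (P *v v)"
    then show "(matrix_inv P ** Q) *v v = \<mu> *\<^sub>R v"
      by (simp add: matrix_vector_mult_scaleR matrix_inv_inverse[OF assms]
          flip: matrix_vector_mul_assoc)
        (simp add: matrix_vector_mul_assoc matrix_inv_inverse[OF assms])
  qed
  then show ?thesis
    by (simp add: eigenvalues_def)
qed

text \<open>The quotient is invariant under scaling of \<open>v\<close>, so its minimum over the
  compact unit sphere is a global one. Multiplying out the denominator lets the bound include
  \<open>v = 0\<close>.\<close>

lemma rayleigh_quotient_minimum:
  fixes P Q :: "real ^ 'n ^ 'n"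
  assumes "\<And>v. v \<noteq> 0 \<Longrightarrow> 0 < v \<bullet> (P *v v)"
  obtains u where "u \<noteq> 0"
    "\<And>v. (u \<bullet> (Q *v u)) / (u \<bullet> (P *v u)) * (v \<bullet> (P *v v)) \<le> v \<bullet> (Q *v v)"
proof -
  let ?r = "\<lambda>v. (v \<bullet> (Q *v v)) / (v \<bullet> (P *v v))"
  have "v \<bullet> (P *v v) \<noteq> 0" if "v \<in> sphere 0 1" for v
    using assms[of v] that by (cases "v = 0") auto
  then have "continuous_on (sphere 0 1) ?r"
    by (intro continuous_intros linear_continuous_on matrix_vector_mul_bounded_linear) blast
  moreover have "sphere 0 1 \<noteq> ({} :: (real ^ 'n) set)"
    by simp
  ultimately have "\<exists>u\<in>sphere 0 1. \<forall>v\<in>sphere 0 1. ?r u \<le> ?r v"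
    by (intro continuous_attains_inf compact_sphere)
  then obtain u where u: "u \<in> sphere 0 1" "\<And>v. v \<in> sphere 0 1 \<Longrightarrow> ?r u \<le> ?r v"
    by blast
  have "?r u * (v \<bullet> (P *v v)) \<le> v \<bullet> (Q *v v)" for v
  proof (cases "v = 0")
    case False
    have "?r (inverse (norm v) *\<^sub>R v) = ?r v"
      using False by (simp add: matrix_vector_mult_scaleR)
    then have "?r u \<le> ?r v"
      using u(2)[of "inverse (norm v) *\<^sub>R v"] False by simp
    then show ?thesis
      using assms[OF False] by (simp add: pos_le_divide_eq)
  qed simp
  moreover have "u \<noteq> 0"
    using u(1) by auto
  ultimately show thesis
    using that by blast
qed

text \<open>The product \<open>matrix_inv P ** Q\<close> need not be symmetric, so its eigenvalues
  are read as those of the pencil \<open>Q *v v = \<mu> *\<^sub>R (P *v v)\<close>. The minimum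
  \<kappa> of the Rayleigh quotient is both the least such \<mu> and the largest \<gamma> for which
  \<open>Q - \<gamma> *\<^sub>R P\<close> is positive semidefinite.\<close>

lemma le_lambda_min_iff:
  fixes P Q :: "real ^ 'n ^ 'n"
  assumes P: "transpose P = P" "\<And>v. v \<noteq> 0 \<Longrightarrow> 0 < v \<bullet> (P *v v)" "invertible P"
    and Q: "transpose Q = Q"
  shows "\<gamma> \<le> lambda_min (matrix_inv P ** Q) \<longleftrightarrow> pos_semidef (Q - \<gamma> *\<^sub>R P)"
proof -
  let ?E = "eigenvalues (matrix_inv P ** Q)"
  have pencil: "v \<bullet> ((Q - \<mu> *\<^sub>R P) *v v) = v \<bullet> (Q *v v) - \<mu> * (v \<bullet> (P *v v))" for \<mu> v
    by (simp add: matrix_vector_mult_diff_rdistrib inner_diff_right flip: scaleR_matrix_vector_assoc)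
  have psd: "pos_semidef (Q - \<mu> *\<^sub>R P) \<longleftrightarrow> (\<forall>v. \<mu> * (v \<bullet> (P *v v)) \<le> v \<bullet> (Q *v v))" for \<mu>
    using P(1) Q unfolding pos_semidef_def pencil by (simp add: transpose_diff transpose_scalar)
  obtain u where u: "u \<noteq> 0"
    "\<And>v. (u \<bullet> (Q *v u)) / (u \<bullet> (P *v u)) * (v \<bullet> (P *v v)) \<le> v \<bullet> (Q *v v)"
    using rayleigh_quotient_minimum[OF P(2)] by blast
  define \<kappa> where "\<kappa> = (u \<bullet> (Q *v u)) / (u \<bullet> (P *v u))"
  have \<kappa>: "\<kappa> * (u \<bullet> (P *v u)) = u \<bullet> (Q *v u)"
    using P(2)[OF u(1)] by (simp add: \<kappa>_def)
  have le: "\<kappa> * (v \<bullet> (P *v v)) \<le> v \<bullet> (Q *v v)" for v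
    using u(2) by (simp add: \<kappa>_def)
  \<comment> \<open>The form of this matrix is nonnegative by \<open>le\<close> and vanishes at
    \<open>u\<close> by the choice of \<kappa>.\<close>
  have "(Q - \<kappa> *\<^sub>R P) *v u = 0"
    using le \<kappa> by (intro pos_semidef_kernel) (simp_all add: psd pencil)
  then have "\<kappa> \<in> ?E"
    unfolding eigenvalues_matrix_inv_mult[OF P(3)] using u(1)
    by (auto simp: matrix_vector_mult_diff_rdistrib simp flip: scaleR_matrix_vector_assoc)
  \<comment> \<open>Pairing the eigenvector equation with \<open>v\<close> shows that \<mu> is the
    Rayleigh quotient at \<open>v\<close>.\<close>
  moreover have "\<kappa> \<le> \<mu>" if \<mu>: "\<mu> \<in> ?E" for \<mu>
  proof -
    obtain v where v: "v \<noteq> 0" "Q *v v = \<mu> *\<^sub>R (P *v v)"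
      using \<mu> eigenvalues_matrix_inv_mult[OF P(3)] by blast
    then show ?thesis
      using le[of v] P(2)[OF v(1)] by simp
  qed
  ultimately have "lambda_min (matrix_inv P ** Q) = \<kappa>"
    unfolding lambda_min_def by (intro Min_eqI finite_eigenvalues)
  moreover have "\<gamma> \<le> \<kappa> \<longleftrightarrow> pos_semidef (Q - \<gamma> *\<^sub>R P)"
  proof
    assume "\<gamma> \<le> \<kappa>"
    then have "\<gamma> * (v \<bullet> (P *v v)) \<le> \<kappa> * (v \<bullet> (P *v v))" for v
      using P(2)[of v] by (cases "v = 0") simp_all
    then show "pos_semidef (Q - \<gamma> *\<^sub>R P)"
      using le psd order_trans by blast
  next
    assume "pos_semidef (Q - \<gamma> *\<^sub>R P)"
    then show "\<gamma> \<le> \<kappa>"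
      using psd \<kappa> P(2)[OF u(1)] by (metis mult_le_cancel_right_pos)
  qed
  ultimately show ?thesis
    by simp
qed

section \<open>Covariance matrices\<close>

text \<open>The finite second moment makes all products of centred components integrable, so the
  double sum from expanding \<open>B *v U \<omega>\<close> can be taken out of the integral.\<close>

lemma covariance_matrix_linear:
  fixes B :: "real ^ 'm ^ 'd" and Y :: "'w \<Rightarrow> real ^ 'm"
  assumes "prob_space M" and meas [measurable]: "Y \<in> borel_measurable M"
    and sq: "integrable M (\<lambda>\<omega>. (norm (Y \<omega>))\<^sup>2)"
  shows "covariance_matrix M (\<lambda>\<omega>. B *v Y \<omega>) = B ** covariance_matrix M Y ** transpose B"
proof -
  interpret prob_space M by fact
  have int: "integrable M Y"
    using square_integrable_imp_integrable[of "\<lambda>\<omega>. norm (Y \<omega>)"] sq integrable_norm_iff[OF meas]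
    by simp
  define U where "U \<omega> = Y \<omega> - integral\<^sup>L M Y" for \<omega>
  have [measurable]: "U \<in> borel_measurable M"
    by (simp add: U_def[abs_def])
  have U_int: "integrable M (\<lambda>\<omega>. U \<omega> $ i * U \<omega> $ j)" for i j
  proof (rule Bochner_Integration.integrable_bound)
    \<comment> \<open>The dominating function comes from bounding each component by the norm, then
      from the triangle inequality and \<open>2 * a * b \<le> a\<^sup>2 + b\<^sup>2\<close>.\<close>
    show "integrable M (\<lambda>\<omega>. 2 * (norm (Y \<omega>))\<^sup>2 + 2 * (norm (integral\<^sup>L M Y))\<^sup>2)"
      using sq by simp
    show "(\<lambda>\<omega>. U \<omega> $ i * U \<omega> $ j) \<in> borel_measurable M"
      by (simp add: cart_eq_inner_axis)
    have "\<bar>U \<omega> $ i * U \<omega> $ j\<bar> \<le> 2 * (norm (Y \<omega>))\<^sup>2 + 2 * (norm (integral\<^sup>L M Y))\<^sup>2" for \<omega>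
    proof -
      have "\<bar>U \<omega> $ i * U \<omega> $ j\<bar> \<le> (norm (U \<omega>))\<^sup>2"
        unfolding abs_mult power2_eq_square by (intro mult_mono component_le_norm_cart) simp_all
      also have "\<dots> \<le> (norm (Y \<omega>) + norm (integral\<^sup>L M Y))\<^sup>2"
        by (simp add: U_def norm_triangle_ineq4 power_mono)
      also have "\<dots> \<le> 2 * (norm (Y \<omega>))\<^sup>2 + 2 * (norm (integral\<^sup>L M Y))\<^sup>2"
        using sum_squares_bound[of "norm (Y \<omega>)" "norm (integral\<^sup>L M Y)"]
        by (simp add: power2_sum)
      finally show ?thesis .
    qed
    then show "AE \<omega> in M. norm (U \<omega> $ i * U \<omega> $ j)
        \<le> norm (2 * (norm (Y \<omega>))\<^sup>2 + 2 * (norm (integral\<^sup>L M Y))\<^sup>2)"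
      by simp
  qed
  have cov: "covariance_matrix M Y $ i $ j = (\<integral>\<omega>. U \<omega> $ i * U \<omega> $ j \<partial>M)" for i j
    by (simp add: covariance_matrix_def U_def)
  have "integral\<^sup>L M (\<lambda>\<omega>. B *v Y \<omega>) = B *v integral\<^sup>L M Y"
    using integral_bounded_linear[OF matrix_vector_mul_bounded_linear int] .
  then have "covariance_matrix M (\<lambda>\<omega>. B *v Y \<omega>) $ i $ j =
      (\<integral>\<omega>. (B *v U \<omega>) $ i * (B *v U \<omega>) $ j \<partial>M)" for i j
    by (simp add: covariance_matrix_def U_def matrix_vector_mult_diff_distrib)
  \<comment> \<open>The sum over \<open>l\<close> stands outside, as it does when the
    left-associated product \<open>B ** C ** transpose B\<close> is unfolded.\<close>
  also have "(\<integral>\<omega>. (B *v U \<omega>) $ i * (B *v U \<omega>) $ j \<partial>M) =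
      (\<integral>\<omega>. (\<Sum>l\<in>UNIV. \<Sum>k\<in>UNIV. B $ i $ k * B $ j $ l * (U \<omega> $ k * U \<omega> $ l)) \<partial>M)" for i j
    by (subst sum.swap) (simp add: matrix_vector_mult_def sum_product mult_ac)
  also have "\<dots> i j = (\<Sum>l\<in>UNIV. \<Sum>k\<in>UNIV. B $ i $ k * B $ j $ l * covariance_matrix M Y $ k $ l)"
    for i j
    using U_int by (simp add: cov Bochner_Integration.integral_sum)
  also have "\<dots> i j = (B ** covariance_matrix M Y ** transpose B) $ i $ j" for i j
    by (simp add: matrix_matrix_mult_def transpose_def sum_distrib_left sum_distrib_right mult_ac)
  finally show ?thesis
    by (simp add: vec_eq_iff)
qed

section \<open>Comparison of the two estimators\<close>

theorem proposition4:
  fixes X :: "real ^ 'n ^ 'p"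
    and A :: "real ^ 'k ^ 'n"
    and P_A :: "real ^ 'n ^ 'n"
    and M_hat :: "real ^ 'k ^ 'p"
    and S Sigma_hat :: "real ^ 'p ^ 'p"
    and V1 V2 :: "real ^ 'k ^ 'k"
    and \<gamma> c :: real
    and \<theta> :: "real ^ 'k"
    and \<Omega> :: "'w measure"
    and y :: "'w \<Rightarrow> real ^ 'p"
    and \<theta>_ATR \<theta>_RTS :: "'w \<Rightarrow> real ^ 'k"
  assumes "CARD('n) < CARD('p)"
    and "rank X = CARD('n)"
    and "rank A = CARD('k)"
    and "P_A = A ** matrix_inv (transpose A ** A) ** transpose A"
    and "M_hat = X ** A ** matrix_inv (transpose A ** A)"
    and "S = X ** (mat 1 - P_A) ** transpose X"
    and "\<gamma> > 0"
    and "c > 0"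
    and "Sigma_hat = c *\<^sub>R (S + \<gamma> *\<^sub>R mat 1)"
    and "\<theta> \<noteq> 0"
    and "prob_space \<Omega>"
    and "y \<in> borel_measurable \<Omega>"
    and "integrable \<Omega> (\<lambda>\<omega>. (norm (y \<omega>))\<^sup>2)"
    and "integral\<^sup>L \<Omega> y = M_hat *v \<theta>"
    and "covariance_matrix \<Omega> y = (norm \<theta>)\<^sup>2 *\<^sub>R Sigma_hat"
    and "\<theta>_ATR = (\<lambda>\<omega>. (matrix_inv (transpose M_hat ** M_hat) ** transpose M_hat) *v y \<omega>)"
    and "\<theta>_RTS = (\<lambda>\<omega>. (transpose A ** matrix_inv (transpose X ** X) ** transpose X) *v y \<omega>)"
    and "V1 = transpose A ** matrix_inv (transpose X ** X) ** A
              - matrix_inv (transpose M_hat ** M_hat)"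
    and "V2 = matrix_inv (transpose M_hat ** M_hat) ** transpose M_hat ** S ** M_hat
              ** matrix_inv (transpose M_hat ** M_hat)"
    and "invertible V1"
  shows "covariance_matrix \<Omega> \<theta>_RTS \<preceq>\<^sub>L covariance_matrix \<Omega> \<theta>_ATR
         \<longleftrightarrow> \<gamma> \<le> lambda_min (matrix_inv V1 ** V2)"
proof -
  define G where "G = matrix_inv (transpose X ** X)"
  define W where "W = matrix_inv (transpose A ** A)"
  define N where "N = matrix_inv (transpose M_hat ** M_hat)"
  define L where "L = transpose A ** G ** transpose X"
  define H where "H = N ** transpose M_hat"
  note P_A = assms(4)[folded W_def] and M_hat = assms(5)[folded W_def] and S = assms(6)
  have inv_X: "invertible (transpose X ** X)" and inv_A: "invertible (transpose A ** A)"
    using assms(2,3) by (auto intro!: invertible_gram simp: full_rank_injective)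
  have G: "G ** transpose X ** X = mat 1" "transpose G = G"
    using matrix_inv_inverse(2)[OF inv_X] symmetric_matrix_inv[OF inv_X symmetric_gram]
    by (simp_all add: G_def matrix_mul_assoc)
  have W: "transpose A ** A ** W = mat 1"
    using matrix_inv_inverse(1)[OF inv_A] by (simp add: W_def)
  have LX: "L ** X = transpose A"
    unfolding L_def by (metis G(1) matrix_mul_assoc matrix_mul_rid)
  have LM: "L ** M_hat = mat 1"
    using LX W by (simp add: M_hat matrix_mul_assoc)
  \<comment> \<open>The left inverse \<open>L\<close> yields full column rank of
    \<open>M_hat\<close> without any rank computation.\<close>
  then have "inj ((*v) M_hat)"
    using matrix_left_invertible_injective by blast
  then have inv_M: "invertible (transpose M_hat ** M_hat)"
    by (rule invertible_gram)
  have N: "N ** transpose M_hat ** M_hat = mat 1" "transpose N = N"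
    using matrix_inv_inverse(2)[OF inv_M] symmetric_matrix_inv[OF inv_M symmetric_gram]
    by (simp_all add: N_def matrix_mul_assoc)
  have tL: "transpose L = X ** G ** A" and tH: "transpose H = M_hat ** N"
    using G(2) N(2) by (simp_all add: L_def H_def matrix_transpose_mul matrix_mul_assoc)
  have LL: "L ** transpose L = transpose A ** G ** A"
    by (simp add: tL LX matrix_mul_assoc)
  have LH: "L ** transpose H = N"
    using LM by (simp add: tH matrix_mul_assoc)
  have HL: "H ** transpose L = N"
    using arg_cong[OF LH, of transpose] N(2) by (simp add: matrix_transpose_mul)
  have HM: "H ** M_hat = mat 1"
    using N(1) by (simp add: H_def)
  have HH: "H ** transpose H = N"
    by (simp add: tH HM matrix_mul_assoc)
  \<comment> \<open>Since \<open>L ** X\<close> is \<open>transpose A\<close>, and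
    \<open>P_A\<close> fixes the column space of \<open>A\<close>, the factor
    \<open>mat 1 - P_A\<close> inside \<open>S\<close> is annihilated.\<close>
  have LSL: "L ** S ** transpose L = 0"
  proof -
    have "transpose A ** P_A = transpose A"
      using W by (simp add: P_A matrix_mul_assoc)
    then have "L ** X ** (mat 1 - P_A) = 0"
      by (simp add: LX matrix_diff_ldistrib)
    then show ?thesis
      by (simp add: S matrix_mul_assoc)
  qed
  have V1: "V1 = transpose A ** G ** A - N" and V2: "V2 = H ** S ** transpose H"
    unfolding tH unfolding assms(18,19) G_def N_def H_def matrix_mul_assoc by (rule refl)+
  \<comment> \<open>Both cross terms and \<open>H ** transpose H\<close> equal \<open>N\<close>, so
    the expansion leaves \<open>L ** transpose L - N\<close>.\<close>
  have V1_square: "V1 = (L - H) ** transpose (L - H)"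
    by (simp add: V1 transpose_diff matrix_diff_ldistrib matrix_diff_rdistrib LL LH HL HH)
  have V1_sym: "transpose V1 = V1"
    by (simp add: V1_square matrix_transpose_mul)
  \<comment> \<open>The square is nonnegative; invertibility of \<open>V1\<close> keeps
    \<open>transpose (L - H) *v v\<close> from vanishing, which makes the inequality strict.\<close>
  have V1_pos: "0 < v \<bullet> (V1 *v v)" if "v \<noteq> 0" for v
  proof -
    have "V1 *v v \<noteq> 0"
      using assms(20) that
      by (metis matrix_inv_inverse(2) matrix_vector_mul_assoc matrix_vector_mul_lid
          matrix_vector_mult_0_right)
    then have "transpose (L - H) *v v \<noteq> 0"
      by (metis V1_square matrix_vector_mul_assoc matrix_vector_mult_0_right)
    then show ?thesis
      unfolding V1_square inner_mult_transpose by (simp del: transpose_matrix_vector)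
  qed
  have "transpose P_A = P_A"
    using symmetric_matrix_inv[OF inv_A symmetric_gram]
    by (simp add: P_A W_def matrix_transpose_mul matrix_mul_assoc)
  then have "transpose S = S"
    by (simp add: S matrix_transpose_mul transpose_diff matrix_mul_assoc)
  then have V2_sym: "transpose V2 = V2"
    by (simp add: V2 matrix_transpose_mul matrix_mul_assoc)
  \<comment> \<open>This scalar is common to both covariance matrices. It is positive, so it does
    not affect the Loewner comparison.\<close>
  define s where "s = (norm \<theta>)\<^sup>2 * c"
  have s: "s > 0"
    using assms(8,10) by (simp add: s_def)
  have cov: "covariance_matrix \<Omega> (\<lambda>\<omega>. B *v y \<omega>) =
      s *\<^sub>R (B ** S ** transpose B + \<gamma> *\<^sub>R (B ** transpose B))" for B :: "real ^ 'p ^ 'k"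
    using covariance_matrix_linear[OF assms(11,12,13), of B]
    by (simp add: assms(9,15) s_def matrix_mult_scaleR_left matrix_mult_scaleR_right
        matrix_add_ldistrib matrix_add_rdistrib_real)
  have "covariance_matrix \<Omega> \<theta>_RTS = s *\<^sub>R (\<gamma> *\<^sub>R (transpose A ** G ** A))"
    unfolding assms(17) G_def[symmetric] L_def[symmetric] cov LSL LL by simp
  moreover have "covariance_matrix \<Omega> \<theta>_ATR = s *\<^sub>R (V2 + \<gamma> *\<^sub>R N)"
    unfolding assms(16) N_def[symmetric] H_def[symmetric] cov HH V2 by simp
  ultimately have "covariance_matrix \<Omega> \<theta>_ATR - covariance_matrix \<Omega> \<theta>_RTS = s *\<^sub>R (V2 - \<gamma> *\<^sub>R V1)"
    by (simp add: V1 algebra_simps)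
  then show ?thesis
    using le_lambda_min_iff[OF V1_sym V1_pos assms(20) V2_sym] pos_semidef_scaleR_iff[OF s]
    by (simp add: loewner_le_def)
qed

end
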